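(* Let $(A,\mu,\{\cdot,\cdot,\cdot\})$ be a non-commutative ternary Nambu-Poisson algebra (respectively, a ternary Nambu-Poisson algebra) and let $\beta:A\to A$ be a Nambu-Poisson algebra morphism. Then $$A_{\beta}=(A,\ \mu_{\beta}=\beta\circ\mu,\ \{\cdot,\cdot,\cdot\}_{\beta}=\beta\circ\{\cdot,\cdot,\cdot\},\ \beta)$$ is a multiplicative non-commutative ternary Hom-Nambu-Poisson algebra (respectively, a multiplicative ternary Hom-Nambu-Poisson algebra).
   Context: $\mathbb{K}$ is an algebraically closed field of characteristic zero; all vector spaces are over $\mathbb{K}$. A non-commutative ternary Nambu-Poisson algebra $(A,\mu,\{\cdot,\cdot,\cdot\})$ is a vector space $A$ with an associative bilinear multiplication $\mu$ and a skew-symmetric trilinear bracket satisfying the fundamental identity $\{x_1,x_2,\{x_3,x_4,x_5\}\}=\{\{x_1,x_2,x_3\},x_4,x_5\}+\{x_3,\{x_1,x_2,x_4\},x_5\}+\{x_3,x_4,\{x_1,x_2,x_5\}\}$ and the Leibniz rule $\{x_1,x_2,\mu(x_3,x_4)\}=\mu(x_3,\{x_1,x_2,x_4\})+\mu(\{x_1,x_2,x_3\},x_4)$. If $\mu$ is commutative it is called a ternary Nambu-Poisson algebra. A Nambu-Poisson algebra morphism is a linear map $f$ preserving the multiplication and the bracket: $f(\mu(x,y))=\mu'(f(x),f(y))$ and $f(\{x,y,z\})=\{f(x),f(y),f(z)\}'$. A non-commutative ternary Hom-Nambu-Poisson algebra $(A,\mu,\{\cdot,\cdot,\cdot\},\alpha)$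 consists of a vector space $A$, a bilinear map $\mu:A\times A\to A$, a trilinear map $\{\cdot,\cdot,\cdot\}:A\times A\times A\to A$ and a linear map $\alpha:A\to A$ such that, for all elements of $A$: (1) (Hom-associativity) $\mu(\alpha(x),\mu(y,z))=\mu(\mu(x,y),\alpha(z))$; (2) the bracket is skew-symmetric, $\{x_{\sigma(1)},x_{\sigma(2)},x_{\sigma(3)}\}=\mathrm{sgn}(\sigma)\{x_1,x_2,x_3\}$ for $\sigma\in S_3$, and satisfies the ternary Hom-Nambu identity $\{\alpha(x_1),\alpha(x_2),\{x_3,x_4,x_5\}\}=\{\{x_1,x_2,x_3\},\alpha(x_4),\alpha(x_5)\}+\{\alpha(x_3),\{x_1,x_2,x_4\},\alpha(x_5)\}+\{\alpha(x_3),\alpha(x_4),\{x_1,x_2,x_5\}\}$; (3) (Hom-Leibniz identity) $\{\mu(x_1,x_2),\alpha(x_3),\alpha(x_4)\}=\mu(\alpha(x_1),\{x_2,x_3,x_4\})+\mu(\{x_1,x_3,x_4\},\alpha(x_2))$. "Non-commutative" means that $\mu$ is not assumed commutative; when $\mu$ is commutative, it is called a ternary Hom-Nambu-Poisson algebra. It is multiplicative if $\alpha(\{x_1,x_2,x_3\})=\{\alpha(x_1),\alpha(x_2),\alpha(x_3)\}$ and $\alpha\circ\mu=\mu\circ\alpha^{\otimes 2}$. *)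

theory Defs
  imports
    Complex_Main
    "HOL-Computational_Algebra.Polynomial"
    "HOL-Combinatorics.Permutations"
begin

text \<open>
  A vector space is given by its scalar multiplication \<open>s\<close> on a type of class
  \<^class>\<open>ab_group_add\<close>, as in \<^locale>\<open>vector_space\<close>. The definitions make sense over any
  field; algebraic closedness and characteristic zero are imposed where needed, through
  the classes \<^class>\<open>alg_closed_field\<close> and \<^class>\<open>field_char_0\<close>.
  The name \<open>linear\<close> must be qualified: in \<^theory>\<open>Complex_Main\<close> the unqualified one is the
  real-linear special case.
\<close>

definition bilinear_map :: "('k::field \<Rightarrow> 'a::ab_group_add \<Rightarrow> 'a) \<Rightarrow> ('a \<Rightarrow> 'a \<Rightarrow> 'a) \<Rightarrow> bool" where
  "bilinear_map s m \<longleftrightarrow>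
     (\<forall>y. Vector_Spaces.linear s s (\<lambda>x. m x y)) \<and>
     (\<forall>x. Vector_Spaces.linear s s (\<lambda>y. m x y))"

definition trilinear_map :: "('k::field \<Rightarrow> 'a::ab_group_add \<Rightarrow> 'a) \<Rightarrow> ('a \<Rightarrow> 'a \<Rightarrow> 'a \<Rightarrow> 'a) \<Rightarrow> bool" where
  "trilinear_map s t \<longleftrightarrow>
     (\<forall>y z. Vector_Spaces.linear s s (\<lambda>x. t x y z)) \<and>
     (\<forall>x z. Vector_Spaces.linear s s (\<lambda>y. t x y z)) \<and>
     (\<forall>x y. Vector_Spaces.linear s s (\<lambda>z. t x y z))"

definition skew_symmetric3 :: "('k::field \<Rightarrow> 'a::ab_group_add \<Rightarrow> 'a) \<Rightarrow> ('a \<Rightarrow> 'a \<Rightarrow> 'a \<Rightarrow> 'a) \<Rightarrow> bool" where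
  "skew_symmetric3 s t \<longleftrightarrow>
     (\<forall>\<sigma> (x :: nat \<Rightarrow> 'a). \<sigma> permutes {1, 2, 3} \<longrightarrow>
        t (x (\<sigma> 1)) (x (\<sigma> 2)) (x (\<sigma> 3)) = s (of_int (sign \<sigma>)) (t (x 1) (x 2) (x 3)))"

locale nc_ternary_Nambu_Poisson_algebra = vector_space s
  for s :: "'k::field \<Rightarrow> 'a::ab_group_add \<Rightarrow> 'a" +
  fixes \<mu> :: "'a \<Rightarrow> 'a \<Rightarrow> 'a"
    and br :: "'a \<Rightarrow> 'a \<Rightarrow> 'a \<Rightarrow> 'a"
  assumes bilinear: "bilinear_map s \<mu>"
    and assoc: "\<mu> (\<mu> x y) z = \<mu> x (\<mu> y z)"
    and trilinear: "trilinear_map s br"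
    and skew_symmetric: "skew_symmetric3 s br"
    and fundamental_identity:
      "br x1 x2 (br x3 x4 x5) =
         br (br x1 x2 x3) x4 x5 + br x3 (br x1 x2 x4) x5 + br x3 x4 (br x1 x2 x5)"
    and Leibniz: "br x1 x2 (\<mu> x3 x4) = \<mu> x3 (br x1 x2 x4) + \<mu> (br x1 x2 x3) x4"

locale ternary_Nambu_Poisson_algebra = nc_ternary_Nambu_Poisson_algebra +
  assumes commute: "\<mu> x y = \<mu> y x"

locale Nambu_Poisson_morphism = Vector_Spaces.linear s s' f
  for s :: "'k::field \<Rightarrow> 'a::ab_group_add \<Rightarrow> 'a"
    and \<mu> :: "'a \<Rightarrow> 'a \<Rightarrow> 'a"
    and br :: "'a \<Rightarrow> 'a \<Rightarrow> 'a \<Rightarrow> 'a"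
    and s' :: "'k \<Rightarrow> 'b::ab_group_add \<Rightarrow> 'b"
    and \<mu>' :: "'b \<Rightarrow> 'b \<Rightarrow> 'b"
    and br' :: "'b \<Rightarrow> 'b \<Rightarrow> 'b \<Rightarrow> 'b"
    and f :: "'a \<Rightarrow> 'b" +
  assumes map_mult: "f (\<mu> x y) = \<mu>' (f x) (f y)"
    and map_bracket: "f (br x y z) = br' (f x) (f y) (f z)"

locale nc_ternary_Hom_Nambu_Poisson_algebra = vector_space s
  for s :: "'k::field \<Rightarrow> 'a::ab_group_add \<Rightarrow> 'a" +
  fixes \<mu> :: "'a \<Rightarrow> 'a \<Rightarrow> 'a"
    and br :: "'a \<Rightarrow> 'a \<Rightarrow> 'a \<Rightarrow> 'a"
    and \<alpha> :: "'a \<Rightarrow> 'a"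
  assumes bilinear: "bilinear_map s \<mu>"
    and trilinear: "trilinear_map s br"
    and linear_twist: "Vector_Spaces.linear s s \<alpha>"
    and Hom_assoc: "\<mu> (\<alpha> x) (\<mu> y z) = \<mu> (\<mu> x y) (\<alpha> z)"
    and skew_symmetric: "skew_symmetric3 s br"
    and Hom_Nambu_identity:
      "br (\<alpha> x1) (\<alpha> x2) (br x3 x4 x5) =
         br (br x1 x2 x3) (\<alpha> x4) (\<alpha> x5) + br (\<alpha> x3) (br x1 x2 x4) (\<alpha> x5)
           + br (\<alpha> x3) (\<alpha> x4) (br x1 x2 x5)"
    and Hom_Leibniz:
      "br (\<mu> x1 x2) (\<alpha> x3) (\<alpha> x4) = \<mu> (\<alpha> x1) (br x2 x3 x4) + \<mu> (br x1 x3 x4) (\<alpha> x2)"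

locale ternary_Hom_Nambu_Poisson_algebra = nc_ternary_Hom_Nambu_Poisson_algebra +
  assumes commute: "\<mu> x y = \<mu> y x"

locale multiplicative_nc_ternary_Hom_Nambu_Poisson_algebra =
  nc_ternary_Hom_Nambu_Poisson_algebra +
  assumes twist_bracket: "\<alpha> (br x1 x2 x3) = br (\<alpha> x1) (\<alpha> x2) (\<alpha> x3)"
    and twist_mult: "\<alpha> (\<mu> x y) = \<mu> (\<alpha> x) (\<alpha> y)"

locale multiplicative_ternary_Hom_Nambu_Poisson_algebra =
  ternary_Hom_Nambu_Poisson_algebra + multiplicative_nc_ternary_Hom_Nambu_Poisson_algebra

end

theory Submission
  imports Defs
begin

text \<open>Since \<beta> preserves product and bracket, every \<beta> inside a twisted expression
  can be pulled outwards: both nested twisted operations and operations on twisted arguments carry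
  exactly two copies of \<beta>. Each Hom-identity for the twisted operations is therefore the image
  under \<beta> composed with itself of the corresponding untwisted identity, by additivity of
  \<beta>. Multilinearity and skew-symmetry survive because \<beta> is linear, and multiplicativity
  is the morphism property itself. The one mismatch is in the Leibniz rules: the product sits in the
  last slot of the bracket in one and in the first slot in the other.
  \<open>skew_symmetric3_rotate\<close> bridges this; \<open>yau_twist_nc\<close> assembles the
  argument.\<close>

text \<open>A 3-cycle is even, so it leaves a skew-symmetric bracket unchanged.\<close>

lemma skew_symmetric3_rotate:
  assumes "vector_space s" and "skew_symmetric3 s t"
  shows "t x y z = t y z x"
proof -
  interpret vector_space s by fact
  \<comment> \<open>The cycle sending 1 to 2, 2 to 3 and 3 to 1, written as two transpositions so
    that its sign can be computed.\<close>
  define \<sigma> :: "nat \<Rightarrow> nat" where "\<sigma> = transpose 1 2 \<circ> transpose 2 3"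
  define v :: "nat \<Rightarrow> 'b" where "v = (\<lambda>i. if i = 1 then x else if i = 2 then y else z)"
  have "\<sigma> permutes {1, 2, 3}"
    unfolding \<sigma>_def by (intro permutes_compose permutes_swap_id) auto
  then have "t (v (\<sigma> 1)) (v (\<sigma> 2)) (v (\<sigma> 3)) = s (of_int (sign \<sigma>)) (t (v 1) (v 2) (v 3))"
    using assms(2) unfolding skew_symmetric3_def by blast
  moreover have "sign \<sigma> = 1"
    unfolding \<sigma>_def by (simp add: sign_compose permutation_swap_id sign_swap_id)
  moreover have "\<sigma> 1 = 2" "\<sigma> 2 = 3" "\<sigma> 3 = 1"
    by (simp_all add: \<sigma>_def transpose_def)
  ultimately show ?thesis
    by (simp add: v_def)
qed

lemma bilinear_map_comp:
  assumes "Vector_Spaces.linear s s f" and "bilinear_map s m"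
  shows "bilinear_map s (\<lambda>x y. f (m x y))"
  unfolding bilinear_map_def
  \<comment> \<open>With the outer map fixed to \<open>f\<close>, unification can only split the
    composite as \<open>f\<close> after a slice of \<open>m\<close>.\<close>
  by (auto intro!: Vector_Spaces.linear_compose[unfolded comp_def, OF _ assms(1)]
      simp: assms(2)[unfolded bilinear_map_def])

lemma trilinear_map_comp:
  assumes "Vector_Spaces.linear s s f" and "trilinear_map s t"
  shows "trilinear_map s (\<lambda>x y z. f (t x y z))"
  unfolding trilinear_map_def
  by (auto intro!: Vector_Spaces.linear_compose[unfolded comp_def, OF _ assms(1)]
      simp: assms(2)[unfolded trilinear_map_def])

text \<open>The sign is a scalar, so it passes through \<open>f\<close> by homogeneity.\<close>

lemma skew_symmetric3_comp:
  assumes "Vector_Spaces.linear s s f" and "skew_symmetric3 s t"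
  shows "skew_symmetric3 s (\<lambda>x y z. f (t x y z))"
proof -
  interpret Vector_Spaces.linear s s f by fact
  show ?thesis
    using assms(2) unfolding skew_symmetric3_def by (simp add: scale)
qed

lemma yau_twist_nc:
  assumes "Nambu_Poisson_morphism s \<mu> br s \<mu> br \<beta>"
    and "nc_ternary_Nambu_Poisson_algebra s \<mu> br"
  shows "multiplicative_nc_ternary_Hom_Nambu_Poisson_algebra s
    (\<lambda>x y. \<beta> (\<mu> x y)) (\<lambda>x y z. \<beta> (br x y z)) \<beta>"
proof -
  interpret \<beta>: Nambu_Poisson_morphism s \<mu> br s \<mu> br \<beta> by fact
  interpret A: nc_ternary_Nambu_Poisson_algebra s \<mu> br by fact
  have lin: "Vector_Spaces.linear s s \<beta>"
    by (fact \<beta>.linear_axioms)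
  have rotate: "br x y z = br y z x" for x y z
    by (rule skew_symmetric3_rotate[OF \<beta>.vs1.vector_space_axioms A.skew_symmetric])
  \<comment> \<open>The derivation property in the first slot, as the Hom-Leibniz identity requires.
    Pinning \<open>x3\<close> and \<open>x4\<close> orients the rotation: it moves only this pair to
    the front.\<close>
  have Leibniz: "br (\<mu> x1 x2) x3 x4 = \<mu> x1 (br x2 x3 x4) + \<mu> (br x1 x3 x4) x2" for x1 x2 x3 x4
    using A.Leibniz[of x3 x4 x1 x2] by (simp only: rotate[of _ x3 x4])
  show ?thesis
  proof unfold_locales
    show "bilinear_map s (\<lambda>x y. \<beta> (\<mu> x y))"
      by (rule bilinear_map_comp[OF lin A.bilinear])
    show "trilinear_map s (\<lambda>x y z. \<beta> (br x y z))"
      by (rule trilinear_map_comp[OF lin A.trilinear])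
    show "skew_symmetric3 s (\<lambda>x y z. \<beta> (br x y z))"
      by (rule skew_symmetric3_comp[OF lin A.skew_symmetric])
    \<comment> \<open>Here and in the next two identities, the morphism laws read from right to left
      collect the inner copies of \<beta> in front of an untwisted expression.\<close>
    show "\<beta> (\<mu> (\<beta> x) (\<beta> (\<mu> y z))) = \<beta> (\<mu> (\<beta> (\<mu> x y)) (\<beta> z))" for x y z
      by (simp add: A.assoc flip: \<beta>.map_mult)
    show "\<beta> (br (\<beta> x1) (\<beta> x2) (\<beta> (br x3 x4 x5))) =
        \<beta> (br (\<beta> (br x1 x2 x3)) (\<beta> x4) (\<beta> x5)) + \<beta> (br (\<beta> x3) (\<beta> (br x1 x2 x4)) (\<beta> x5))
          + \<beta> (br (\<beta> x3) (\<beta> x4) (\<beta> (br x1 x2 x5)))" for x1 x2 x3 x4 x5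
      by (simp add: A.fundamental_identity[of x1 x2 x3 x4 x5] \<beta>.add flip: \<beta>.map_bracket)
    show "\<beta> (br (\<beta> (\<mu> x1 x2)) (\<beta> x3) (\<beta> x4)) =
        \<beta> (\<mu> (\<beta> x1) (\<beta> (br x2 x3 x4))) + \<beta> (\<mu> (\<beta> (br x1 x3 x4)) (\<beta> x2))" for x1 x2 x3 x4
      by (simp add: Leibniz \<beta>.add flip: \<beta>.map_bracket \<beta>.map_mult)
  \<comment> \<open>What remains is linearity of the twist and multiplicativity.\<close>
  qed (simp_all add: lin \<beta>.map_bracket \<beta>.map_mult)
qed

lemma yau_twist:
  assumes "Nambu_Poisson_morphism s \<mu> br s \<mu> br \<beta>"
    and "ternary_Nambu_Poisson_algebra s \<mu> br"
  shows "multiplicative_ternary_Hom_Nambu_Poisson_algebra s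
    (\<lambda>x y. \<beta> (\<mu> x y)) (\<lambda>x y z. \<beta> (br x y z)) \<beta>"
proof -
  interpret A: ternary_Nambu_Poisson_algebra s \<mu> br by fact
  interpret twist: multiplicative_nc_ternary_Hom_Nambu_Poisson_algebra s
    "\<lambda>x y. \<beta> (\<mu> x y)" "\<lambda>x y z. \<beta> (br x y z)" \<beta>
    by (rule yau_twist_nc[OF assms(1) A.nc_ternary_Nambu_Poisson_algebra_axioms])
  show ?thesis
    \<comment> \<open>Only commutativity is left, and it is \<beta> applied to commutativity of
      \<mu>.\<close>
    by unfold_locales (rule arg_cong[OF A.commute])
qed

theorem corollary4p3:
  fixes s :: "'k::{alg_closed_field, field_char_0} \<Rightarrow> 'a::ab_group_add \<Rightarrow> 'a"
    and \<mu> :: "'a \<Rightarrow> 'a \<Rightarrow> 'a"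
    and br :: "'a \<Rightarrow> 'a \<Rightarrow> 'a \<Rightarrow> 'a"
    and \<beta> :: "'a \<Rightarrow> 'a"
  assumes morphism: "Nambu_Poisson_morphism s \<mu> br s \<mu> br \<beta>"
  shows "(nc_ternary_Nambu_Poisson_algebra s \<mu> br \<longrightarrow>
            multiplicative_nc_ternary_Hom_Nambu_Poisson_algebra s
              (\<lambda>x y. \<beta> (\<mu> x y)) (\<lambda>x y z. \<beta> (br x y z)) \<beta>)
       \<and> (ternary_Nambu_Poisson_algebra s \<mu> br \<longrightarrow>
            multiplicative_ternary_Hom_Nambu_Poisson_algebra s
              (\<lambda>x y. \<beta> (\<mu> x y)) (\<lambda>x y z. \<beta> (br x y z)) \<beta>)"
  using yau_twist_nc[OF morphism] yau_twist[OF morphism] by blast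

end
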